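(* Let $E$ be an elliptic curve over $\mathbb{R}$, with discriminant $\Delta_E$, and let $E(\mathbb{R})$ be the Lie group of real points of $E$. Then $E(\mathbb{R})$ admits a continuous inverse ambiguous function $f : E(\mathbb{R}) \to E(\mathbb{R})$ if and only if $\Delta_E > 0$.
   Context: For a group $G$, a function $f : G \to G$ is called inverse ambiguous if it is bijective and its inverse function satisfies $f^{-1}(x) = (f(x))^{-1}$ for all $x \in G$, where the right-hand side is the group inverse of $f(x)$. Equivalently, $f(f(x)) = x^{-1}$ for all $x \in G$ (written additively on an elliptic curve: $f(f(P)) = -P$). Up to isomorphism, an elliptic curve over $\mathbb{R}$ is given by a Weierstrass equation $Y^2 = X^3 + aX + b$ with $a, b \in \mathbb{R}$, together with the point at infinity $O = [0,1,0]$ (the identity of the group law), with discriminant $\Delta_E = -16(4a^3 + 27b^2) \neq 0$. The set $E(\mathbb{R})$ carries the topology induced from the real projective plane. It is a known fact that $E(\mathbb{R})$ is isomorphic as a Lie group to $S^1$ if $\Delta_E < 0$ and to $S^1 \times \mathbb{Z}_2$ if $\Delta_E > 0$. *)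

(* Continuous inverse ambiguous functions on real elliptic curves *)
theory Defs
  imports "HOL-Analysis.Analysis" "HOL-Algebra.Group"
begin

definition proj_rel :: "real \<times> real \<times> real \<Rightarrow> real \<times> real \<times> real \<Rightarrow> bool" where
  "proj_rel v w \<longleftrightarrow> v \<noteq> 0 \<and> (\<exists>c. c \<noteq> 0 \<and> w = c *\<^sub>R v)"

lemma part_equivp_proj_rel: "part_equivp proj_rel"
proof (rule part_equivpI)
  show "\<exists>v. proj_rel v v"
    by (rule exI[of _ "(1, 0, 0)"]) (auto simp: proj_rel_def zero_prod_def intro: exI[of _ 1])
  show "symp proj_rel"
  proof (rule sympI)
    fix v w assume "proj_rel v w"
    then obtain c where "v \<noteq> 0" "c \<noteq> 0" "w = c *\<^sub>R v"
      by (auto simp: proj_rel_def)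
    then show "proj_rel w v"
      by (auto simp: proj_rel_def intro!: exI[of _ "inverse c"])
  qed
  show "transp proj_rel"
  proof (rule transpI)
    fix u v w assume "proj_rel u v" "proj_rel v w"
    then obtain c d where "u \<noteq> 0" "c \<noteq> 0" "v = c *\<^sub>R u" "d \<noteq> 0" "w = d *\<^sub>R v"
      by (auto simp: proj_rel_def)
    then show "proj_rel u w"
      by (auto simp: proj_rel_def intro!: exI[of _ "d * c"])
  qed
qed

quotient_type rp2 = "real \<times> real \<times> real" / partial: proj_rel
  by (rule part_equivp_proj_rel)

text \<open>The homogeneous point \<open>[x, y, z]\<close>; unspecified if \<open>(x, y, z) = 0\<close>.\<close>

definition homog :: "real \<Rightarrow> real \<Rightarrow> real \<Rightarrow> rp2" where
  "homog x y z = abs_rp2 (x, y, z)"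

text \<open>The quotient topology of \<open>\<real>\<^sup>3 - {0}\<close>.\<close>

instantiation rp2 :: topological_space
begin

definition open_rp2 :: "rp2 set \<Rightarrow> bool" where
  "open_rp2 U \<longleftrightarrow> open {v. v \<noteq> 0 \<and> abs_rp2 v \<in> U}"

instance
proof
  have "{v :: real \<times> real \<times> real. v \<noteq> 0} = - {0}"
    by auto
  then show "open (UNIV :: rp2 set)"
    by (simp add: open_rp2_def open_Compl)
next
  fix S T :: "rp2 set"
  assume "open S" "open T"
  moreover have "{v. v \<noteq> 0 \<and> abs_rp2 v \<in> S \<inter> T} =
      {v. v \<noteq> 0 \<and> abs_rp2 v \<in> S} \<inter> {v. v \<noteq> 0 \<and> abs_rp2 v \<in> T}"
    by auto
  ultimately show "open (S \<inter> T)"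
    by (simp only: open_rp2_def open_Int)
next
  fix K :: "rp2 set set"
  assume "\<forall>S\<in>K. open S"
  moreover have "{v. v \<noteq> 0 \<and> abs_rp2 v \<in> \<Union>K} = (\<Union>S\<in>K. {v. v \<noteq> 0 \<and> abs_rp2 v \<in> S})"
    by auto
  ultimately show "open (\<Union>K)"
    by (simp only: open_rp2_def) (auto intro!: open_UN)
qed

end

definition discriminant :: "real \<Rightarrow> real \<Rightarrow> real" where
  "discriminant a b = - 16 * (4 * a ^ 3 + 27 * b ^ 2)"

definition real_points :: "real \<Rightarrow> real \<Rightarrow> rp2 set" where
  "real_points a b =
    {homog x y z | x y z. (x, y, z) \<noteq> 0 \<and> y ^ 2 * z = x ^ 3 + a * x * z ^ 2 + b * z ^ 3}"

definition infinity_point :: rp2 where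
  "infinity_point = homog 0 1 0"

text \<open>Affine coordinates, meaningful for points not on the line \<open>z = 0\<close>. The point at
  infinity is the only point of a curve on that line.\<close>

lift_definition affine_x :: "rp2 \<Rightarrow> real" is "\<lambda>(x, y, z). x / z"
  by (auto simp: proj_rel_def)

lift_definition affine_y :: "rp2 \<Rightarrow> real" is "\<lambda>(x, y, z). y / z"
  by (auto simp: proj_rel_def)

text \<open>The chord and tangent law: \<open>m\<close> is the slope of the line through \<open>P\<close> and \<open>Q\<close>, which is the
  tangent line if \<open>P = Q\<close>.\<close>

definition ec_add :: "real \<Rightarrow> rp2 \<Rightarrow> rp2 \<Rightarrow> rp2" where
  "ec_add a P Q =
    (if P = infinity_point then Q
     else if Q = infinity_point then P
     else
       let x1 = affine_x P; y1 = affine_y P; x2 = affine_x Q; y2 = affine_y Q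
       in if x1 = x2 \<and> y1 = - y2 then infinity_point
          else
            let m = (if x1 = x2 then (3 * x1 ^ 2 + a) / (2 * y1) else (y2 - y1) / (x2 - x1));
                x3 = m ^ 2 - x1 - x2
            in homog x3 (m * (x1 - x3) - y1) 1)"

definition ec_group :: "real \<Rightarrow> real \<Rightarrow> rp2 monoid" where
  "ec_group a b = \<lparr>carrier = real_points a b, mult = ec_add a, one = infinity_point\<rparr>"

definition inverse_ambiguous :: "('g, 'm) monoid_scheme \<Rightarrow> ('g \<Rightarrow> 'g) \<Rightarrow> bool" where
  "inverse_ambiguous G f \<longleftrightarrow>
    bij_betw f (carrier G) (carrier G) \<and>
    (\<forall>x\<in>carrier G. inv_into (carrier G) f x = inv\<^bsub>G\<^esub> (f x))"

end

(* The map f is inverse ambiguous iff f (f P) = - P.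

   If e is a root of the cubic, the discriminant is -16 (a + 3 e^2)^2 (4 a + 3 e^2), where
   a + 3 e^2 and - (4 a + 3 e^2) are the constant term and the discriminant of the cofactor of
   x - e, written in terms of u = x - e.

   Negative discriminant: negation has two fixed points, whose complement has the components
   y > 0 and y < 0. A continuous f with f o f = negation permutes the fixed points and the two
   components, so f o f preserves each component, whereas negation exchanges them.

   Positive discriminant: translation by the 2-torsion point (e, 0), e the smallest root, exchanges
   the two components of the curve and commutes with negation. Composing it with negation on one
   of them gives f. *)
theory Submission
  imports Defs
begin

section \<open>Homogeneous coordinates on the real projective plane\<close>

lemma abs_rp2_eq_iff:
  assumes "v \<noteq> 0" "w \<noteq> 0"
  shows "abs_rp2 v = abs_rp2 w \<longleftrightarrow> (\<exists>c. c \<noteq> 0 \<and> w = c *\<^sub>R v)"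
proof -
  have "proj_rel v v" "proj_rel w w"
    using assms by (auto simp: proj_rel_def intro: exI[of _ 1])
  then show ?thesis
    using Quotient3_rel[OF Quotient3_rp2, of v w] assms by (auto simp: proj_rel_def)
qed

lemma abs_rp2_scaleR: "v \<noteq> 0 \<Longrightarrow> c \<noteq> 0 \<Longrightarrow> abs_rp2 (c *\<^sub>R v) = abs_rp2 v"
  by (metis abs_rp2_eq_iff scaleR_eq_0_iff)

text \<open>The quotient is partial, with only nonzero vectors related to themselves, so a
  representative chosen by \<open>rep_rp2\<close> is nonzero.\<close>

lemma abs_rp2_cases: obtains v where "v \<noteq> 0" "P = abs_rp2 v"
proof -
  have "proj_rel (rep_rp2 P) (rep_rp2 P)" "abs_rp2 (rep_rp2 P) = P"
    using Quotient3_rep_reflp[OF Quotient3_rp2] Quotient3_abs_rep[OF Quotient3_rp2] by auto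
  then show ?thesis
    using that by (metis proj_rel_def)
qed

lemma homog_scale:
  assumes "(x, y, z) \<noteq> 0" "c \<noteq> 0"
  shows "homog (c * x) (c * y) (c * z) = homog x y z"
  using abs_rp2_scaleR[OF assms] by (simp add: homog_def)

lemma homog_eqI:
  assumes "(x, y, z) \<noteq> 0" "c \<noteq> 0" "x' = c * x" "y' = c * y" "z' = c * z"
  shows "homog x' y' z' = homog x y z"
  using homog_scale assms by simp

lemma affine_homog [simp]:
  assumes "(x, y, z) \<noteq> 0"
  shows "affine_x (homog x y z) = x / z" "affine_y (homog x y z) = y / z"
proof -
  have "proj_rel (x, y, z) (x, y, z)"
    using assms by (auto simp: proj_rel_def intro: exI[of _ 1])
  then show "affine_x (homog x y z) = x / z" "affine_y (homog x y z) = y / z"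
    unfolding homog_def by (simp_all add: affine_x.abs_eq affine_y.abs_eq)
qed

lemma homog_1_ne_infinity [simp]: "homog x y 1 \<noteq> infinity_point"
  by (auto simp: infinity_point_def homog_def abs_rp2_eq_iff zero_prod_def)

lemma homog_1_eq_iff [simp]: "homog x y 1 = homog x' y' 1 \<longleftrightarrow> x = x' \<and> y = y'"
proof
  assume *: "homog x y 1 = homog x' y' 1"
  have "affine_x (homog x y 1) = affine_x (homog x' y' 1)"
    "affine_y (homog x y 1) = affine_y (homog x' y' 1)"
    unfolding * by (rule refl)+
  then show "x = x' \<and> y = y'" by (simp add: zero_prod_def)
qed simp

lemma homog_affine: "z \<noteq> 0 \<Longrightarrow> homog x y z = homog (x / z) (y / z) 1"
  by (rule homog_eqI[where c = z]) (auto simp: zero_prod_def)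

lemma homog_infinity: "y \<noteq> 0 \<Longrightarrow> homog 0 y 0 = infinity_point"
  unfolding infinity_point_def by (rule homog_eqI[where c = y]) (auto simp: zero_prod_def)

section \<open>Points of the curve: infinity and the affine points\<close>

lemma infinity_in_real_points: "infinity_point \<in> real_points a b"
  unfolding real_points_def infinity_point_def
  by (intro CollectI exI[of _ 0] exI[of _ 1]) (auto simp: zero_prod_def)

lemma homog_in_real_points_iff [simp]:
  "homog x y 1 \<in> real_points a b \<longleftrightarrow> y ^ 2 = x ^ 3 + a * x + b"
proof
  assume "homog x y 1 \<in> real_points a b"
  then obtain x' y' z' where *: "homog x y 1 = homog x' y' z'" "(x', y', z') \<noteq> 0"
    "y' ^ 2 * z' = x' ^ 3 + a * x' * z' ^ 2 + b * z' ^ 3"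
    by (auto simp: real_points_def)
  \<comment> \<open>With \<open>z' = 0\<close> the equation forces \<open>x' = 0\<close>, and the
    point would be infinity.\<close>
  have z: "z' \<noteq> 0"
    using * homog_infinity[of y'] homog_1_ne_infinity[of x y] by (auto simp: zero_prod_def)
  then have "x' = x * z'" "y' = y * z'"
    using *(1) homog_affine[OF z] by auto
  then have "z' ^ 3 * y ^ 2 = z' ^ 3 * (x ^ 3 + a * x + b)"
    using *(3) by (simp add: algebra_simps power2_eq_square power3_eq_cube)
  then show "y ^ 2 = x ^ 3 + a * x + b"
    using z by simp
next
  assume "y ^ 2 = x ^ 3 + a * x + b"
  then show "homog x y 1 \<in> real_points a b"
    unfolding real_points_def
    by (intro CollectI exI[of _ x] exI[of _ y] exI[of _ 1]) (auto simp: zero_prod_def)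
qed

lemma real_points_cases:
  assumes "P \<in> real_points a b"
  obtains "P = infinity_point" | x y where "P = homog x y 1" "y ^ 2 = x ^ 3 + a * x + b"
proof -
  obtain x y z where *: "P = homog x y z" "(x, y, z) \<noteq> 0"
    "y ^ 2 * z = x ^ 3 + a * x * z ^ 2 + b * z ^ 3"
    using assms by (auto simp: real_points_def)
  show ?thesis
  proof (cases "z = 0")
    case True
    then have "P = infinity_point"
      using * homog_infinity[of y] by (auto simp: zero_prod_def)
    then show ?thesis using that by blast
  next
    case False
    then have "P = homog (x / z) (y / z) 1"
      using *(1) homog_affine[OF False] by simp
    moreover from this have "(y / z) ^ 2 = (x / z) ^ 3 + a * (x / z) + b"
      using assms by simp
    ultimately show ?thesis by (rule that(2))
  qed
qed

section \<open>Negation and inverse ambiguous maps\<close>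

definition ec_neg :: "rp2 \<Rightarrow> rp2" where
  "ec_neg P = (if P = infinity_point then infinity_point else homog (affine_x P) (- affine_y P) 1)"

lemma ec_neg_simps [simp]:
  "ec_neg infinity_point = infinity_point"
  "ec_neg (homog x y 1) = homog x (- y) 1"
  by (auto simp: ec_neg_def zero_prod_def)

lemma ec_neg_in: "P \<in> real_points a b \<Longrightarrow> ec_neg P \<in> real_points a b"
  by (erule real_points_cases) (simp_all add: infinity_in_real_points)

lemma ec_neg_neg: "P \<in> real_points a b \<Longrightarrow> ec_neg (ec_neg P) = P"
  by (erule real_points_cases) simp_all

text \<open>The chord and tangent formulas always return a point with last coordinate 1, so infinity
  arises only from the case of opposite points or from two neutral arguments.\<close>

lemma ec_add_eq_infinity_iff:
  assumes "P \<in> real_points a b" "Q \<in> real_points a b"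
  shows "ec_add a P Q = infinity_point \<longleftrightarrow> Q = ec_neg P"
  using assms(1)
proof (cases rule: real_points_cases)
  case 1
  then show ?thesis by (simp add: ec_add_def)
next
  case P: (2 x y)
  from assms(2) show ?thesis
  proof (cases rule: real_points_cases)
    case 1
    then show ?thesis using P by (auto simp: ec_add_def dest: sym)
  next
    case Q: (2 x' y')
    then show ?thesis
      using P by (auto simp: ec_add_def Let_def zero_prod_def)
  qed
qed

text \<open>The inverse is a definite description. \<open>ec_add_eq_infinity_iff\<close>, applied on
  either side, gives existence and uniqueness.\<close>

lemma inv_ec_group:
  assumes "P \<in> real_points a b"
  shows "inv\<^bsub>ec_group a b\<^esub> P = ec_neg P"
proof -
  have "ec_add a Q P = infinity_point \<longleftrightarrow> Q = ec_neg P"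
    if "Q \<in> real_points a b" for Q
    using ec_add_eq_infinity_iff[OF that assms] ec_neg_neg assms that by metis
  then show ?thesis
    unfolding m_inv_def
    by (intro the_equality)
      (auto simp: ec_group_def ec_neg_in[OF assms] ec_add_eq_infinity_iff[OF assms])
qed

text \<open>Bijectivity is implicit in the functional equation: since negation is an involution, the
  map sending P to \<open>ec_neg (f P)\<close> inverts f on both sides.\<close>

lemma inverse_ambiguous_ec_group_iff:
  "inverse_ambiguous (ec_group a b) f \<longleftrightarrow>
    f ` real_points a b \<subseteq> real_points a b \<and> (\<forall>P\<in>real_points a b. f (f P) = ec_neg P)"
  (is "?L \<longleftrightarrow> ?R")
proof
  let ?E = "real_points a b"
  have carr: "carrier (ec_group a b) = ?E"
    by (simp add: ec_group_def)
  {
    assume L: ?L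
    then have bij: "bij_betw f ?E ?E"
      and inv: "\<And>P. P \<in> ?E \<Longrightarrow> inv_into ?E f P = inv\<^bsub>ec_group a b\<^esub> (f P)"
      by (auto simp: inverse_ambiguous_def carr)
    have im: "f P \<in> ?E" if "P \<in> ?E" for P
      using bij that by (auto simp: bij_betw_def)
    have "f (f P) = ec_neg P" if P: "P \<in> ?E" for P
    proof -
      have "P = inv_into ?E f (f P)"
        using bij P by (simp add: bij_betw_def)
      also have "\<dots> = ec_neg (f (f P))"
        using inv im P by (simp add: inv_ec_group)
      finally show ?thesis
        using ec_neg_neg im P by metis
    qed
    then show ?R using im by auto
  }
  {
    assume ?R
    then have im: "\<And>P. P \<in> ?E \<Longrightarrow> f P \<in> ?E" and ff: "\<And>P. P \<in> ?E \<Longrightarrow> f (f P) = ec_neg P"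
      by auto
    have inj: "inj_on f ?E"
      by (rule inj_on_inverseI[where g = "\<lambda>Q. ec_neg (f Q)"]) (simp add: ff ec_neg_neg)
    have inv: "f (ec_neg (f P)) = P" if "P \<in> ?E" for P
    proof -
      \<comment> \<open>Evaluating the threefold iterate in two ways shows that f commutes with
        negation.\<close>
      have "f (f (f P)) = ec_neg (f P)"
        using ff im that by blast
      then have "f (ec_neg P) = ec_neg (f P)"
        using ff that by simp
      then have "f (ec_neg (f P)) = f (f (ec_neg P))"
        by simp
      also have "\<dots> = P"
        using ff ec_neg_in ec_neg_neg that by simp
      finally show ?thesis .
    qed
    have surj: "f ` ?E = ?E"
    proof (intro subset_antisym subsetI)
      fix P assume "P \<in> ?E"
      then show "P \<in> f ` ?E"
        using inv im ec_neg_in by (intro image_eqI[where x = "ec_neg (f P)"]) auto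
    qed (use im in auto)
    have "inv_into ?E f P = ec_neg (f P)" if "P \<in> ?E" for P
      using that by (intro inv_into_f_eq[OF inj]) (simp_all add: inv im ec_neg_in)
    then show ?L
      using inj surj im by (simp add: inverse_ambiguous_def carr bij_betw_def inv_ec_group)
  }
qed

section \<open>Topology of the projective plane\<close>

lemma continuous_on_abs_rp2: "continuous_on {v. v \<noteq> 0} abs_rp2"
proof -
  have "{v :: real \<times> real \<times> real. v \<noteq> 0} = - {0}"
    by auto
  then have "open {v :: real \<times> real \<times> real. v \<noteq> 0}"
    by (simp add: open_Compl)
  moreover have "abs_rp2 -` B \<inter> {v. v \<noteq> 0} = {v. v \<noteq> 0 \<and> abs_rp2 v \<in> B}" for B
    by auto
  ultimately show ?thesis
    by (simp add: continuous_on_open_vimage open_rp2_def)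
qed

lemma continuous_on_homog:
  assumes "continuous_on S f" "continuous_on S g" "continuous_on S h"
    and "\<And>t. t \<in> S \<Longrightarrow> (f t, g t, h t) \<noteq> 0"
  shows "continuous_on S (\<lambda>t. homog (f t) (g t) (h t))"
  unfolding homog_def
  by (rule continuous_on_compose2[OF continuous_on_abs_rp2])
    (use assms in \<open>auto intro!: continuous_intros\<close>)

text \<open>The saturation of an open set is the union of its nonzero scalings, each of which is
  open.\<close>

lemma open_map_abs_rp2:
  assumes "open A"
  shows "open (abs_rp2 ` (A - {0}))"
proof -
  have "{v. v \<noteq> 0 \<and> abs_rp2 v \<in> abs_rp2 ` (A - {0})} = (\<Union>c\<in>-{0}. (*\<^sub>R) c ` (A - {0}))"
  proof (intro subset_antisym subsetI)
    fix v assume "v \<in> {v. v \<noteq> 0 \<and> abs_rp2 v \<in> abs_rp2 ` (A - {0})}"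
    then have "v \<noteq> 0" "abs_rp2 v \<in> abs_rp2 ` (A - {0})"
      by simp_all
    then obtain w where w: "w \<in> A - {0}" "abs_rp2 w = abs_rp2 v"
      by (metis imageE)
    then obtain c where "c \<noteq> 0" "v = c *\<^sub>R w"
      using abs_rp2_eq_iff \<open>v \<noteq> 0\<close> by auto
    then show "v \<in> (\<Union>c\<in>-{0}. (*\<^sub>R) c ` (A - {0}))"
      using w by auto
  next
    fix v assume "v \<in> (\<Union>c\<in>-{0}. (*\<^sub>R) c ` (A - {0}))"
    then show "v \<in> {v. v \<noteq> 0 \<and> abs_rp2 v \<in> abs_rp2 ` (A - {0})}"
      by (elim UN_E imageE) (auto simp: abs_rp2_scaleR simp del: scaleR_Pair)
  qed
  then show ?thesis
    unfolding open_rp2_def using assms by (auto intro!: open_UN open_scaling open_Diff)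
qed

text \<open>Restricting a quotient map to the preimage of an arbitrary set \<open>S\<close> gives a quotient map
  here because the projection to the projective plane is open.\<close>

lemma continuous_on_rp2I:
  fixes f :: "rp2 \<Rightarrow> 'a :: topological_space"
  assumes "continuous_on {v. v \<noteq> 0 \<and> abs_rp2 v \<in> S} (\<lambda>v. f (abs_rp2 v))"
  shows "continuous_on S f"
  unfolding continuous_on_open_invariant
proof (intro allI impI)
  fix B :: "'a set" assume "open B"
  then obtain A where A: "open A"
    "A \<inter> {v. v \<noteq> 0 \<and> abs_rp2 v \<in> S} = (\<lambda>v. f (abs_rp2 v)) -` B \<inter> {v. v \<noteq> 0 \<and> abs_rp2 v \<in> S}"
    using assms unfolding continuous_on_open_invariant by blast
  have mem: "v \<in> A \<longleftrightarrow> f (abs_rp2 v) \<in> B" if "v \<noteq> 0" "abs_rp2 v \<in> S" for v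
    using A(2) that by auto
  have "abs_rp2 ` (A - {0}) \<inter> S = f -` B \<inter> S"
  proof (intro subset_antisym subsetI)
    fix P assume "P \<in> f -` B \<inter> S"
    moreover obtain v where "v \<noteq> 0" "P = abs_rp2 v"
      by (rule abs_rp2_cases)
    ultimately show "P \<in> abs_rp2 ` (A - {0}) \<inter> S"
      using mem by auto
  qed (use mem in auto)
  then show "\<exists>A. open A \<and> A \<inter> S = f -` B \<inter> S"
    using open_map_abs_rp2[OF A(1)] by blast
qed

text \<open>Serves to glue formulas that are valid only on parts of an open cover.\<close>

lemma continuous_on_local:
  fixes f :: "'a :: t2_space \<Rightarrow> 'b :: topological_space"
  assumes "\<And>x. x \<in> S \<Longrightarrow> \<exists>W. open W \<and> x \<in> W \<and> continuous_on (S \<inter> W) f"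
  shows "continuous_on S f"
  unfolding continuous_on_eq_continuous_within
proof
  fix x assume x: "x \<in> S"
  then obtain W where W: "open W" "x \<in> W" "continuous_on (S \<inter> W) f"
    using assms by blast
  then have "continuous (at x within (S \<inter> W)) f"
    using x by (auto simp: continuous_on_eq_continuous_within)
  moreover have "at x within (S \<inter> W) = at x within S"
    by (rule at_within_nhd[OF W(2,1)]) auto
  ultimately show "continuous (at x within S) f"
    by (simp add: continuous_within)
qed

text \<open>The sign of y / z is that of the product y z, also for z = 0, where division yields 0.
  Positivity of a continuous function on the vectors is an open condition.\<close>

lemma open_affine_y: "open {P. affine_y P > 0}" "open {P. affine_y P < 0}"
proof -
  have affine_y_abs: "affine_y (abs_rp2 (x, y, z)) = y / z" if "(x, y, z) \<noteq> 0" for x y z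
    using affine_homog(2)[OF that] by (simp add: homog_def)
  have "{v. v \<noteq> 0 \<and> abs_rp2 v \<in> {P. 0 < s * affine_y P}} =
      {v. 0 < s * (fst (snd v) * snd (snd v))}" for s
  proof (intro Collect_cong)
    fix v :: "real \<times> real \<times> real"
    obtain x y z where v: "v = (x, y, z)" by (cases v)
    show "v \<noteq> 0 \<and> abs_rp2 v \<in> {P. 0 < s * affine_y P} \<longleftrightarrow> 0 < s * (fst (snd v) * snd (snd v))"
    proof (cases "v = 0")
      case False
      then show ?thesis
        using affine_y_abs[of x y z] v by (auto simp: zero_less_mult_iff zero_less_divide_iff
          mult_less_0_iff divide_less_0_iff)
    qed (simp add: v zero_prod_def)
  qed
  then have "open {P. 0 < s * affine_y P}" for s
    unfolding open_rp2_def by (auto intro!: open_Collect_less continuous_intros)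
  from this[of 1] this[of "-1"] show "open {P. affine_y P > 0}" "open {P. affine_y P < 0}"
    by simp_all
qed

section \<open>The cubic and its real roots\<close>

text \<open>Taylor expansion of the cubic at its root \<open>e\<close>.\<close>

lemma weierstrass_factor:
  fixes a b e x :: real
  assumes "e ^ 3 + a * e + b = 0"
  shows "x ^ 3 + a * x + b = (x - e) * ((x - e) ^ 2 + 3 * e * (x - e) + (3 * e ^ 2 + a))"
  using assms by algebra

lemma discriminant_root:
  assumes "e ^ 3 + a * e + b = 0"
  shows "discriminant a b = - 16 * ((a + 3 * e ^ 2) ^ 2 * (4 * a + 3 * e ^ 2))"
proof -
  have "b = - (e ^ 3 + a * e)" using assms by simp
  then show ?thesis unfolding discriminant_def \<open>b = _\<close> by algebra
qed

text \<open>Intermediate value theorem. Started at the left critical point of the cubic, it yields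
  the smallest root.\<close>

lemma weierstrass_root_below:
  fixes a b m :: real
  assumes "m ^ 3 + a * m + b > 0"
  obtains e where "e < m" "e ^ 3 + a * e + b = 0"
proof -
  \<comment> \<open>Chosen so that - M lies to the left of \<open>m\<close> and M^3 dominates the
    lower terms: M^3 \<ge> M^2 \<ge> (1 + |a| + |b|) M.\<close>
  define M where "M = 1 + \<bar>a\<bar> + \<bar>b\<bar> + \<bar>m\<bar>"
  have M: "M \<ge> 1" "- M \<le> m" "M \<ge> 1 + \<bar>a\<bar> + \<bar>b\<bar>"
    by (auto simp: M_def)
  have "(1 + \<bar>a\<bar> + \<bar>b\<bar>) * M \<le> M * M"
    using M by (intro mult_right_mono) auto
  moreover have "M * M * 1 \<le> M * M * M"
    using M by (intro mult_left_mono) auto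
  moreover have "- a * M \<le> \<bar>a\<bar> * M" "\<bar>b\<bar> * 1 \<le> \<bar>b\<bar> * M"
    using M by (intro mult_right_mono mult_left_mono; simp)+
  moreover have "(- M) ^ 3 + a * (- M) + b = - a * M + b - M * M * M"
    by (simp add: power3_eq_cube)
  ultimately have "(- M) ^ 3 + a * (- M) + b \<le> 0"
    using M unfolding distrib_right by linarith
  then have "\<exists>e. - M \<le> e \<and> e \<le> m \<and> e ^ 3 + a * e + b = 0"
    using assms M by (intro IVT') (auto intro!: continuous_intros)
  then show ?thesis
    using assms that by (metis less_irrefl order_le_less)
qed

section \<open>Negative discriminant: no continuous solution\<close>

lemma connected_graph_homog:
  fixes h :: "real \<Rightarrow> real"
  assumes "continuous_on {e<..} h"
  shows "connected ((\<lambda>x. homog x (h x) 1) ` {e<..})"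
  by (intro connected_continuous_image continuous_on_homog continuous_intros assms)
    (auto simp: zero_prod_def)

lemma no_continuous_inverse_ambiguous:
  assumes disc: "discriminant a b < 0"
    and ia: "inverse_ambiguous (ec_group a b) f"
    and cont: "continuous_on (real_points a b) f"
  shows False
proof -
  let ?E = "real_points a b"
  have im: "f P \<in> ?E" and ff: "f (f P) = ec_neg P" if "P \<in> ?E" for P
    using ia that by (auto simp: inverse_ambiguous_ec_group_iff)
  \<comment> \<open>Large enough for the cubic to be positive: m^2 + a \<ge> 1 and m + b >
    0.\<close>
  define m where "m = 1 + \<bar>a\<bar> + \<bar>b\<bar>"
  have "m * (m ^ 2 + a) + b > 0"
  proof -
    have "m * 1 \<le> m * m" by (intro mult_left_mono) (auto simp: m_def)
    then have "m ^ 2 + a \<ge> 1" unfolding power2_eq_square using m_def by linarith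
    then have "m * 1 \<le> m * (m ^ 2 + a)" by (intro mult_left_mono) (auto simp: m_def)
    then show ?thesis unfolding mult_1_right using m_def by linarith
  qed
  then have "m ^ 3 + a * m + b > 0" by (simp add: algebra_simps power2_eq_square power3_eq_cube)
  then obtain e where e: "e ^ 3 + a * e + b = 0"
    by (rule weierstrass_root_below)
  have "(a + 3 * e ^ 2) ^ 2 * (4 * a + 3 * e ^ 2) > 0"
    using disc discriminant_root[OF e] by simp
  then have quad: "4 * a + 3 * e ^ 2 > 0"
    by (simp add: zero_less_mult_iff)
  \<comment> \<open>The cofactor of x - e has negative discriminant, so \<open>e\<close> is the only
    real root and the cubic is positive exactly to its right.\<close>
  have q_pos: "t ^ 2 + 3 * e * t + (3 * e ^ 2 + a) > 0" for t
  proof -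
    have "t ^ 2 + 3 * e * t + (3 * e ^ 2 + a) = (t + 3 / 2 * e) ^ 2 + (4 * a + 3 * e ^ 2) / 4"
      by (simp add: power2_eq_square field_simps)
    then show ?thesis using quad by (simp add: add_nonneg_pos)
  qed
  define g where "g x = x ^ 3 + a * x + b" for x
  have g_pos: "g x > 0 \<longleftrightarrow> x > e" for x
    unfolding g_def weierstrass_factor[OF e] using q_pos[of "x - e"]
    by (simp add: zero_less_mult_iff less_imp_not_less)
  \<comment> \<open>The sign \<open>s\<close> treats the halves y > 0 and y < 0 together; each is
    the graph of a function over the ray x > e.\<close>
  define half where "half s = {P \<in> ?E. P \<noteq> infinity_point \<and> s * affine_y P > 0}" for s :: real
  have half_eq: "half s = (\<lambda>x. homog x (s * sqrt (g x)) 1) ` {e<..}" if s: "s = 1 \<or> s = -1" for s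
  proof (intro subset_antisym subsetI)
    fix P assume P: "P \<in> half s"
    then have "P \<in> ?E" by (simp add: half_def)
    then show "P \<in> (\<lambda>x. homog x (s * sqrt (g x)) 1) ` {e<..}"
    proof (cases rule: real_points_cases)
      case 1
      then show ?thesis using P by (simp add: half_def)
    next
      case (2 x y)
      then have sy: "s * y > 0" using P by (simp add: half_def zero_prod_def)
      have "y\<^sup>2 = g x" using 2 by (simp add: g_def)
      moreover have "y \<noteq> 0" using sy by auto
      ultimately have "g x > 0" using zero_less_power2[of y] by simp
      then have "x > e" using g_pos by simp
      moreover have "y = s * sqrt (g x)"
        using sy s \<open>y\<^sup>2 = g x\<close>[symmetric] by auto
      ultimately show ?thesis using 2 by auto
    qed
  next
    fix P assume "P \<in> (\<lambda>x. homog x (s * sqrt (g x)) 1) ` {e<..}"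
    then obtain x where x: "x > e" "P = homog x (s * sqrt (g x)) 1" by auto
    then have "g x > 0" using g_pos by simp
    then show "P \<in> half s"
      using x s by (auto simp: half_def zero_prod_def power_mult_distrib g_def)
  qed
  have conn: "connected (half s)" if "s = 1 \<or> s = -1" for s
    unfolding half_eq[OF that] g_def by (intro connected_graph_homog continuous_intros)
  have fixed: "ec_neg P \<noteq> P \<longleftrightarrow> P \<in> half 1 \<union> half (-1)" if "P \<in> ?E" for P
    using that by (cases rule: real_points_cases) (auto simp: half_def zero_prod_def)
  have neg_half: "ec_neg P \<in> half (- s)" if "P \<in> half s" for P s
  proof -
    have "P \<in> ?E" using that by (simp add: half_def)
    then show ?thesis
      using that ec_neg_in[OF \<open>P \<in> ?E\<close>]
      by (cases rule: real_points_cases) (auto simp: half_def zero_prod_def)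
  qed
  have disj: "P \<in> half s \<Longrightarrow> P \<notin> half (- s)" for P s
    by (auto simp: half_def)
  have f_nonfixed: "f P \<in> half 1 \<union> half (-1)" if "P \<in> half s" "s = 1 \<or> s = -1" for P s
  proof -
    have E: "P \<in> ?E" using that by (auto simp: half_def)
    have "ec_neg P \<noteq> P" using fixed[OF E] that by auto
    \<comment> \<open>The fourth iterate of f is the identity. If f P is fixed by negation, the
      third iterate at P equals f P; applying f once more gives P = \<open>ec_neg P\<close>.\<close>
    moreover have "ec_neg P = P" if "ec_neg (f P) = f P"
    proof -
      have "ec_neg P = f (f (f (f P)))"
        using ff[OF E] ff[OF im[OF E]] that by simp
      also have "\<dots> = P"
        using ff[OF E] ff[OF im[OF im[OF E]]] ec_neg_neg[OF E] by simp
      finally show ?thesis .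
    qed
    ultimately show ?thesis
      using fixed[OF im[OF E]] by blast
  qed
  \<comment> \<open>A connected image cannot meet both of the disjoint open sets y > 0 and y <
    0.\<close>
  have dich: "f ` half s \<subseteq> half 1 \<or> f ` half s \<subseteq> half (-1)" if s: "s = 1 \<or> s = -1" for s
  proof -
    have "connected (f ` half s)"
      by (intro connected_continuous_image continuous_on_subset[OF cont] conn[OF s])
        (auto simp: half_def)
    moreover have sub: "f ` half s \<subseteq> half 1 \<union> half (-1)"
      using f_nonfixed s by blast
    then have "f ` half s \<subseteq> {P. affine_y P > 0} \<union> {P. affine_y P < 0}"
      by (auto simp: half_def)
    moreover have "{P. affine_y P > 0} \<inter> {P. affine_y P < 0} \<inter> f ` half s = {}"
      by auto
    ultimately have "{P. affine_y P > 0} \<inter> f ` half s = {} \<or> {P. affine_y P < 0} \<inter> f ` half s = {}"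
      by (metis connectedD open_affine_y)
    then show ?thesis
      using sub by (auto simp: half_def)
  qed
  \<comment> \<open>Otherwise f o f would keep the half, while negation moves it to the other
    one.\<close>
  have not_self: "\<not> f ` half s \<subseteq> half s" if s: "s = 1 \<or> s = -1" for s
  proof
    assume *: "f ` half s \<subseteq> half s"
    obtain P where P: "P \<in> half s"
      unfolding half_eq[OF s] by (meson gt_ex greaterThan_iff imageI)
    then have "f (f P) \<in> half s" using * by auto
    moreover have "f (f P) \<in> half (- s)"
      using ff neg_half[OF P] P by (auto simp: half_def)
    ultimately show False using disj by blast
  qed
  obtain P where P: "P \<in> half 1"
    unfolding half_eq[OF disjI1[OF refl]] by (meson gt_ex greaterThan_iff imageI)
  have "f ` half 1 \<subseteq> half (-1)" "f ` half (-1) \<subseteq> half 1"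
    using dich[of 1] dich[of "-1"] not_self[of 1] not_self[of "-1"] by simp_all
  then have "f (f P) \<in> half 1" using P by auto
  moreover have "f (f P) \<in> half (-1)"
    using ff neg_half[OF P] P by (auto simp: half_def)
  ultimately show False using disj by blast
qed

section \<open>Positive discriminant: the smallest root and the map\<close>

text \<open>In u = x - e the other two roots have sum - 3 e and product k^2. So \<open>k\<close> is
  their geometric mean, and the last inequality is that of the arithmetic and geometric means:
  \<open>k\<close> lies strictly in the gap between them.\<close>

lemma positive_discriminant_root:
  assumes "discriminant a b > 0"
  obtains e k where "e ^ 3 + a * e + b = 0" "k > 0" "k ^ 2 = 3 * e ^ 2 + a" "3 * e + 2 * k < 0"
proof -
  \<comment> \<open>The local maximum of the cubic. Its value there is 2/3 a m + b, and positive
    discriminant means b^2 < (2/3 a m)^2.\<close>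
  define m where "m = - sqrt (- a / 3)"
  have neg: "4 * a ^ 3 + 27 * b ^ 2 < 0"
    using assms by (simp add: discriminant_def)
  have "a < 0"
  proof (rule ccontr)
    assume "\<not> a < 0"
    then have "4 * a ^ 3 + 27 * b ^ 2 \<ge> 0" by simp
    with neg show False by simp
  qed
  then have m: "m ^ 2 = - a / 3" "m < 0"
    by (auto simp: m_def)
  have "(2 / 3 * a * m) ^ 2 = 4 / 9 * a ^ 2 * (- a / 3)"
    unfolding power_mult_distrib m(1) by (simp add: power2_eq_square)
  also have "\<dots> = - 4 / 27 * a ^ 3"
    by (simp add: power2_eq_square power3_eq_cube)
  finally have "b ^ 2 < (2 / 3 * a * m) ^ 2"
    using neg by simp
  moreover have "2 / 3 * a * m > 0"
    using m \<open>a < 0\<close> by (simp add: zero_less_mult_iff)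
  ultimately have "\<bar>b\<bar> < 2 / 3 * a * m"
    using abs_le_square_iff[of "2 / 3 * a * m" b] by linarith
  moreover have "m ^ 3 + a * m = m * (m ^ 2 + a)"
    by (simp add: algebra_simps power2_eq_square power3_eq_cube)
  then have "m ^ 3 + a * m = 2 / 3 * a * m"
    using m by simp
  ultimately have "m ^ 3 + a * m + b > 0"
    by linarith
  then obtain e where e: "e < m" "e ^ 3 + a * e + b = 0"
    by (rule weierstrass_root_below)
  \<comment> \<open>To the left of the critical point the derivative 3 e^2 + a is positive.\<close>
  have "m ^ 2 < e ^ 2"
    using power_strict_mono[of "- m" "- e" 2] e m by simp
  then have K: "3 * e ^ 2 + a > 0"
    using m by simp
  define k where "k = sqrt (3 * e ^ 2 + a)"
  have k: "k > 0" "k ^ 2 = 3 * e ^ 2 + a"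
    using K by (auto simp: k_def)
  have "(a + 3 * e ^ 2) ^ 2 * (4 * a + 3 * e ^ 2) < 0"
    using assms discriminant_root[OF e(2)] by simp
  then have "4 * a + 3 * e ^ 2 < 0"
    by (simp add: mult_less_0_iff)
  then have "(2 * k) ^ 2 < (- 3 * e) ^ 2"
    using k by (simp add: power_mult_distrib)
  then have "2 * k < - 3 * e"
    by (rule power_less_imp_less_base) (use e m in simp)
  then show ?thesis
    using that[OF e(2) k] by simp
qed

text \<open>Away from the 2-torsion point \<open>T = (e, 0)\<close> and infinity, translation by \<open>T\<close> is
  \<open>(u, y) \<mapsto> (K / u, - K y / u\<^sup>2)\<close> with \<open>u = x - e\<close> and \<open>K = k\<^sup>2\<close>. It interchanges the oval \<open>u < k\<close>
  with the unbounded component \<open>u > k\<close>. The map below is this translation on the oval and its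
  negative on the other component.\<close>

definition half_negation :: "real \<Rightarrow> real \<Rightarrow> rp2 \<Rightarrow> rp2" where
  "half_negation e k P =
    (if P = infinity_point then homog e 0 1
     else let u = affine_x P - e; y = affine_y P in
       if u = 0 then infinity_point
       else homog (e + k ^ 2 / u) ((if u < k then - 1 else 1) * k ^ 2 * y / u ^ 2) 1)"

lemma half_negation_infinity [simp]: "half_negation e k infinity_point = homog e 0 1"
  by (simp add: half_negation_def)

lemma half_negation_affine [simp]:
  "half_negation e k (homog x y 1) =
    (if x = e then infinity_point
     else homog (e + k ^ 2 / (x - e)) ((if x - e < k then - 1 else 1) * k ^ 2 * y / (x - e) ^ 2) 1)"
  by (simp add: half_negation_def Let_def zero_prod_def)

context
  fixes a b e k :: real
  assumes root: "e ^ 3 + a * e + b = 0" and k_pos: "k > 0"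
    and k_sq: "k ^ 2 = 3 * e ^ 2 + a" and k_less: "3 * e + 2 * k < 0"
begin

lemma shifted_equation:
  "x ^ 3 + a * x + b = (x - e) * ((x - e) ^ 2 + 3 * e * (x - e) + k ^ 2)"
  using weierstrass_factor[OF root] k_sq by simp

text \<open>For u = x - e < 0 the quadratic cofactor is positive, so the cubic is negative; at u = k
  the cubic equals k^2 (3 e + 2 k) < 0. Hence the test u < k separates the two components.\<close>

lemma shifted_coordinate:
  assumes "y ^ 2 = x ^ 3 + a * x + b"
  shows "x - e \<ge> 0" "x - e \<noteq> k"
proof -
  have e: "e < 0" using k_pos k_less by simp
  show "x - e \<ge> 0"
  proof (rule ccontr)
    assume u: "\<not> x - e \<ge> 0"
    then have "3 * e * (x - e) > 0"
      using e by (intro mult_neg_neg) auto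
    then have "(x - e) ^ 2 + 3 * e * (x - e) + k ^ 2 > 0"
      using k_pos by (intro add_pos_pos) (auto intro: add_nonneg_pos)
    then have "(x - e) * ((x - e) ^ 2 + 3 * e * (x - e) + k ^ 2) < 0"
      using u by (intro mult_neg_pos) auto
    then show False
      using assms shifted_equation[of x] by (metis not_less zero_le_power2)
  qed
  show "x - e \<noteq> k"
  proof
    assume "x - e = k"
    then have "y ^ 2 = k ^ 2 * (3 * e + 2 * k)"
      using assms shifted_equation[of x] by (simp add: algebra_simps power2_eq_square)
    also have "\<dots> < 0"
      using k_pos k_less by (intro mult_pos_neg) auto
    finally show False by simp
  qed
qed

text \<open>With q(u) = u^2 + 3 e u + k^2 one has q(k^2 / u) = (k^2 / u^2) q(u), so replacing u by
  k^2 / u multiplies y^2 by k^4 / u^4. The sign of y disappears on squaring.\<close>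

lemma half_negation_in:
  assumes "P \<in> real_points a b"
  shows "half_negation e k P \<in> real_points a b"
  using assms
proof (cases rule: real_points_cases)
  case 1
  then show ?thesis using root by simp
next
  case (2 x y)
  show ?thesis
  proof (cases "x = e")
    case False
    define u where "u = x - e"
    have u: "u \<noteq> 0" using False by (simp add: u_def)
    define s :: real where "s = (if u < k then - 1 else 1)"
    have s: "s ^ 2 = 1" by (simp add: s_def)
    have y: "y ^ 2 = u * (u ^ 2 + 3 * e * u + k ^ 2)"
      using 2 shifted_equation[of x] by (simp add: u_def)
    have "(s * k ^ 2 * y / u ^ 2) ^ 2 = s ^ 2 * k ^ 4 * y ^ 2 / u ^ 4"
      by (simp add: power_divide power_mult_distrib flip: power_mult)
    also have "\<dots> = k ^ 2 / u * ((k ^ 2 / u) ^ 2 + 3 * e * (k ^ 2 / u) + k ^ 2)"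
      unfolding s y using u by (simp add: field_simps eval_nat_numeral)
    also have "\<dots> = (e + k ^ 2 / u) ^ 3 + a * (e + k ^ 2 / u) + b"
      unfolding shifted_equation by simp
    finally show ?thesis
      using 2 False by (simp flip: u_def s_def)
  qed (use 2 in \<open>simp add: infinity_in_real_points\<close>)
qed

text \<open>The involution u -> k^2 / u exchanges the two sides of \<open>k\<close>, so exactly one
  of the two applications contributes the sign - 1. Infinity and (e, 0) are exchanged, and both
  equal their negatives.\<close>

lemma half_negation_twice:
  assumes "P \<in> real_points a b"
  shows "half_negation e k (half_negation e k P) = ec_neg P"
  using assms
proof (cases rule: real_points_cases)
  case 1
  then show ?thesis
    by simp
next
  case (2 x y)
  show ?thesis
  proof (cases "x = e")
    case True
    then have "y = 0"
      using 2 root by simp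
    then show ?thesis
      using 2 True by simp
  next
    case False
    define u where "u = x - e"
    have u: "u > 0" "u \<noteq> k" "x = e + u"
      using False shifted_coordinate[OF 2(2)] by (auto simp: u_def)
    have "k ^ 2 / u < k \<longleftrightarrow> \<not> u < k"
      using u k_pos by (auto simp: power2_eq_square divide_less_eq)
    moreover have "k ^ 2 * (k ^ 2 * y / u ^ 2) / (k ^ 2 / u) ^ 2 = y"
      using u k_pos by (simp add: field_simps)
    ultimately show ?thesis
      using 2(1) u k_pos by auto
  qed
qed

section \<open>Continuity of the map\<close>

text \<open>The cone over the curve without its apex, in the form in which
  \<open>continuous_on_rp2I\<close> asks for continuity.\<close>

definition curve_lift :: "(real \<times> real \<times> real) set" where
  "curve_lift = {v. v \<noteq> 0 \<and> abs_rp2 v \<in> real_points a b}"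

lemma curve_liftD:
  assumes "(x, y, z) \<in> curve_lift"
  shows "z \<noteq> 0 \<Longrightarrow> homog x y z = homog (x / z) (y / z) 1"
    and "z \<noteq> 0 \<Longrightarrow> (y / z) ^ 2 = (x / z) ^ 3 + a * (x / z) + b"
    and "z = 0 \<Longrightarrow> x = 0 \<and> y \<noteq> 0 \<and> homog x y z = infinity_point"
proof -
  have nz: "(x, y, z) \<noteq> 0" and E: "homog x y z \<in> real_points a b"
    using assms by (auto simp: curve_lift_def homog_def)
  show "homog x y z = homog (x / z) (y / z) 1" "(y / z) ^ 2 = (x / z) ^ 3 + a * (x / z) + b"
    if "z \<noteq> 0"
    using homog_affine[OF that] E by auto
  show "x = 0 \<and> y \<noteq> 0 \<and> homog x y z = infinity_point" if "z = 0"
    using E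
  proof (cases rule: real_points_cases)
    case 1
    then have "abs_rp2 (0, 1, 0) = abs_rp2 (x, y, z)"
      by (simp add: homog_def infinity_point_def)
    moreover have "((0, 1, 0) :: real \<times> real \<times> real) \<noteq> 0"
      by (simp add: zero_prod_def)
    ultimately obtain c where "c \<noteq> 0" "(x, y, z) = c *\<^sub>R (0, 1, 0)"
      using nz abs_rp2_eq_iff by blast
    then show ?thesis using 1 by simp
  next
    case (2 x' y')
    then have "abs_rp2 (x', y', 1) = abs_rp2 (x, y, z)"
      by (simp add: homog_def)
    moreover have "(x', y', 1 :: real) \<noteq> 0"
      by (simp add: zero_prod_def)
    ultimately obtain c where "c \<noteq> 0" "(x, y, z) = c *\<^sub>R (x', y', 1)"
      using nz abs_rp2_eq_iff by blast
    then show ?thesis using that by simp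
  qed
qed

text \<open>Separates the scale z from the affine coordinates, so that homogeneous identities on the
  cone become computations with \<open>u\<close> and \<open>w\<close>.\<close>

lemma curve_lift_cases [consumes 1, case_names infinity affine]:
  assumes "(x, y, z) \<in> curve_lift"
  obtains "x = 0" "z = 0" "y \<noteq> 0" "half_negation e k (homog x y z) = homog e 0 1"
  | u w where "z \<noteq> 0" "x = (e + u) * z" "y = w * z" "w ^ 2 = u * (u ^ 2 + 3 * e * u + k ^ 2)"
    "u \<ge> 0" "u \<noteq> k"
    "half_negation e k (homog x y z) = (if u = 0 then infinity_point else
      homog (e + k ^ 2 / u) ((if u < k then - 1 else 1) * k ^ 2 * w / u ^ 2) 1)"
proof (cases "z = 0")
  case True
  then show ?thesis
    using curve_liftD(3)[OF assms True] that(1) half_negation_infinity by metis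
next
  case False
  note * = curve_liftD(1,2)[OF assms False]
  show ?thesis
    using shifted_coordinate[OF *(2)] False *(1) *(2)[unfolded shifted_equation]
    by (intro that(2)[of "x / z - e" "y / z"]) simp_all
qed

text \<open>The three formulas below represent the same map in homogeneous coordinates
  \<open>[u, y, z]\<close>; they differ by factors that are homogeneous functions on the curve.\<close>

lemma half_negation_oval:
  assumes "(x, y, z) \<in> curve_lift" "(x - e * z - k * z) * z < 0" "x - e * z \<noteq> 0"
  shows "half_negation e k (homog x y z) =
    homog (k ^ 2 * (x - e * z) * z + e * (x - e * z) ^ 2) (- (k ^ 2 * y * z)) ((x - e * z) ^ 2)"
  using assms(1)
proof (cases rule: curve_lift_cases)
  case infinity
  then show ?thesis using assms by simp
next
  case (affine u w)
  have u: "x - e * z = u * z" "u \<noteq> 0"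
    using affine assms(3) by (auto simp: algebra_simps)
  \<comment> \<open>The extra factor z in the hypothesis makes its degree even, so its sign does not
    depend on the representative.\<close>
  have "(u - k) * z ^ 2 < 0"
    using assms(2) unfolding u by (simp add: algebra_simps power2_eq_square)
  then have "u < k"
    by (simp add: mult_less_0_iff)
  then have "half_negation e k (homog x y z) = homog (e + k ^ 2 / u) (- (k ^ 2 * w / u ^ 2)) 1"
    using affine u by simp
  also have "\<dots> = homog (k ^ 2 * (x - e * z) * z + e * (x - e * z) ^ 2) (- (k ^ 2 * y * z)) ((x - e * z) ^ 2)"
    unfolding u using affine(1,3) u(2)
    by (intro homog_eqI[symmetric, where c = "u ^ 2 * z ^ 2"])
      (auto simp: zero_prod_def field_simps power2_eq_square)
  finally show ?thesis .
qed

text \<open>Covers the neighbourhood of (e, 0), where u = x - e z vanishes. On the curve y^2 z = u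
  q, so multiplying the coordinates in \<open>half_negation_oval\<close> by y / u gives these, which
  make sense at u = 0.\<close>

lemma half_negation_oval':
  assumes "(x, y, z) \<in> curve_lift" "(x - e * z - k * z) * z < 0"
    and q: "q = (x - e * z) ^ 2 + 3 * e * (x - e * z) * z + k ^ 2 * z ^ 2" "q \<noteq> 0"
  shows "half_negation e k (homog x y z) =
    homog (k ^ 2 * y * z + e * (x - e * z) * y) (- (k ^ 2 * q)) ((x - e * z) * y)"
  using assms(1)
proof (cases rule: curve_lift_cases)
  case infinity
  then show ?thesis using assms by simp
next
  case (affine u w)
  have u: "x - e * z = u * z"
    using affine by (auto simp: algebra_simps)
  have q': "q = z ^ 2 * (u ^ 2 + 3 * e * u + k ^ 2)"
    unfolding q u by (simp add: algebra_simps power2_eq_square)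
  have w: "z ^ 2 * w ^ 2 = u * q"
    unfolding q' affine(4) by simp
  have "(u - k) * z ^ 2 < 0"
    using assms(2) unfolding u by (simp add: algebra_simps power2_eq_square)
  then have uk: "u < k"
    by (simp add: mult_less_0_iff)
  show ?thesis
  proof (cases "u = 0")
    case True
    then have "w = 0" using affine(4) by simp
    then show ?thesis
      using affine u q(2) k_pos True by (simp add: homog_infinity)
  next
    case False
    then have "w \<noteq> 0" using w q(2) by auto
    have "q = z ^ 2 * w ^ 2 / u"
      using w False by simp
    then have "- (k ^ 2 * q) = u * w * z ^ 2 * (- (k ^ 2 * w / u ^ 2))"
      using False by (simp add: field_simps power2_eq_square)
    then have "homog (k ^ 2 * y * z + e * (x - e * z) * y) (- (k ^ 2 * q)) ((x - e * z) * y) =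
        homog (e + k ^ 2 / u) (- (k ^ 2 * w / u ^ 2)) 1"
      unfolding u using affine(1,3) False \<open>w \<noteq> 0\<close>
      by (intro homog_eqI[where c = "u * w * z ^ 2"])
        (auto simp: zero_prod_def field_simps power2_eq_square)
    then show ?thesis
      using affine False uk by simp
  qed
qed

text \<open>On the curve d z = u^3, so scaling the affine image by d = u^3 / z clears the
  denominators. At infinity d = y^2, and the formula extends there with value (e, 0).\<close>

lemma half_negation_unbounded:
  fixes x y z :: real
  defines "u \<equiv> x - e * z"
  defines "d \<equiv> y ^ 2 - 3 * e * u ^ 2 - k ^ 2 * u * z"
  assumes "(x, y, z) \<in> curve_lift" "(u - k * z) * z > 0 \<or> z = 0"
  shows "half_negation e k (homog x y z) = homog (k ^ 2 * u ^ 2 + e * d) (k ^ 2 * y * u) d \<and> d \<noteq> 0"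
  using assms(3)
proof (cases rule: curve_lift_cases)
  case infinity
  then show ?thesis
    using homog_eqI[of e 0 1 d "e * d" 0 d] by (simp add: u_def d_def zero_prod_def mult.commute)
next
  case (affine t w)
  have u: "u = t * z"
    using affine by (auto simp: u_def algebra_simps)
  have d: "d = t ^ 3 * z ^ 2"
    unfolding d_def u affine(3) power_mult_distrib affine(4)
    by (simp add: algebra_simps power2_eq_square power3_eq_cube)
  have "(t - k) * z ^ 2 > 0"
    using assms(4) affine(1) unfolding u by (simp add: algebra_simps power2_eq_square)
  then have t: "t > k" "t \<noteq> 0"
    using k_pos by (auto simp: zero_less_mult_iff)
  then have "half_negation e k (homog x y z) = homog (e + k ^ 2 / t) (k ^ 2 * w / t ^ 2) 1"
    using affine by simp
  also have "\<dots> = homog (k ^ 2 * u ^ 2 + e * d) (k ^ 2 * y * u) d"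
    unfolding u d using affine(1,3) t
    by (intro homog_eqI[symmetric, where c = "t ^ 3 * z ^ 2"])
      (auto simp: zero_prod_def field_simps power2_eq_square power3_eq_cube)
  finally show ?thesis
    using d t affine(1) by simp
qed

text \<open>On the curve \<open>d z = (u - k z)\<^sup>3\<close>, so that \<open>d > 0\<close> describes the unbounded component
  including the point at infinity.\<close>

lemma unbounded_component_iff:
  fixes x y z :: real
  defines "u \<equiv> x - e * z"
  defines "d \<equiv> y ^ 2 - (3 * e + 3 * k) * u ^ 2 + 2 * k ^ 2 * u * z - k ^ 3 * z ^ 2"
  assumes "(x, y, z) \<in> curve_lift"
  shows "d > 0 \<longleftrightarrow> (u - k * z) * z > 0 \<or> z = 0"
  using assms(3)
proof (cases rule: curve_lift_cases)
  case infinity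
  then show ?thesis by (simp add: u_def d_def)
next
  case (affine t w)
  have u: "u = t * z"
    using affine by (auto simp: u_def algebra_simps)
  have d: "d = (t - k) ^ 3 * z ^ 2"
    unfolding d_def u affine(3) power_mult_distrib affine(4)
    by (simp add: algebra_simps power2_eq_square power3_eq_cube)
  have "(u - k * z) * z = (t - k) * z ^ 2"
    unfolding u by (simp add: algebra_simps power2_eq_square)
  then show ?thesis
    using affine(1) d by (simp add: zero_less_mult_iff zero_less_power_eq)
qed

lemma continuous_on_half_negation: "continuous_on (real_points a b) (half_negation e k)"
proof (rule continuous_on_rp2I, fold curve_lift_def, rule continuous_on_local)
  fix v assume v: "v \<in> curve_lift"
  let ?x = "\<lambda>v :: real \<times> real \<times> real. fst v"
  let ?y = "\<lambda>v :: real \<times> real \<times> real. fst (snd v)"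
  let ?z = "\<lambda>v :: real \<times> real \<times> real. snd (snd v)"
  let ?u = "\<lambda>v. ?x v - e * ?z v"
  let ?q = "\<lambda>v. ?u v ^ 2 + 3 * e * ?u v * ?z v + k ^ 2 * ?z v ^ 2"
  let ?d = "\<lambda>v. ?y v ^ 2 - (3 * e + 3 * k) * ?u v ^ 2 + 2 * k ^ 2 * ?u v * ?z v - k ^ 3 * ?z v ^ 2"
  let ?D = "\<lambda>v. ?y v ^ 2 - 3 * e * ?u v ^ 2 - k ^ 2 * ?u v * ?z v"
  let ?A = "{v. (?u v - k * ?z v) * ?z v < 0} \<inter> {v. ?u v \<noteq> 0}"
  let ?B = "{v. (?u v - k * ?z v) * ?z v < 0} \<inter> {v. ?q v \<noteq> 0}"
  \<comment> \<open>Positivity of \<open>?d\<close> is an open condition that includes infinity,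
    whereas "(u - k z) z > 0 or z = 0" is not evidently open.\<close>
  let ?C = "{v. 0 < ?d v}"
  have "open ?A" "open ?B" "open ?C"
    by (intro open_Int open_Collect_less open_Collect_neq continuous_intros)+
  have A: "continuous_on (curve_lift \<inter> ?A) (\<lambda>v. half_negation e k (abs_rp2 v))"
  proof (rule continuous_on_eq)
    show "continuous_on (curve_lift \<inter> ?A) (\<lambda>v. homog (k ^ 2 * ?u v * ?z v + e * ?u v ^ 2)
        (- (k ^ 2 * ?y v * ?z v)) (?u v ^ 2))"
      by (intro continuous_on_homog continuous_intros) (auto simp: zero_prod_def)
  qed (use half_negation_oval in \<open>auto simp: homog_def\<close>)
  have B: "continuous_on (curve_lift \<inter> ?B) (\<lambda>v. half_negation e k (abs_rp2 v))"
  proof (rule continuous_on_eq)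
    show "continuous_on (curve_lift \<inter> ?B) (\<lambda>v. homog (k ^ 2 * ?y v * ?z v + e * ?u v * ?y v)
        (- (k ^ 2 * ?q v)) (?u v * ?y v))"
      using k_pos by (intro continuous_on_homog continuous_intros) (auto simp: zero_prod_def)
  qed (use half_negation_oval'[OF _ _ refl] in \<open>auto simp: homog_def\<close>)
  have C: "continuous_on (curve_lift \<inter> ?C) (\<lambda>v. half_negation e k (abs_rp2 v))"
  proof (rule continuous_on_eq)
    have eq: "half_negation e k (homog x y z) =
        homog (k ^ 2 * ?u v ^ 2 + e * ?D v) (k ^ 2 * y * ?u v) (?D v) \<and> ?D v \<noteq> 0"
      if "v = (x, y, z)" "v \<in> curve_lift \<inter> ?C" for v x y z
      using that half_negation_unbounded[of x y z] unbounded_component_iff[of x y z] by simp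
    show "continuous_on (curve_lift \<inter> ?C) (\<lambda>v. homog (k ^ 2 * ?u v ^ 2 + e * ?D v)
        (k ^ 2 * ?y v * ?u v) (?D v))"
    proof (intro continuous_on_homog continuous_intros)
      fix v assume "v \<in> curve_lift \<inter> ?C"
      then have "?D v \<noteq> 0"
        using eq[of v "?x v" "?y v" "?z v"] by simp
      then show "(k ^ 2 * ?u v ^ 2 + e * ?D v, k ^ 2 * ?y v * ?u v, ?D v) \<noteq> 0"
        by (simp add: zero_prod_def)
    qed
    show "homog (k ^ 2 * ?u v ^ 2 + e * ?D v) (k ^ 2 * ?y v * ?u v) (?D v) =
        half_negation e k (abs_rp2 v)" if "v \<in> curve_lift \<inter> ?C" for v
      using eq[OF _ that, of "?x v" "?y v" "?z v"] by (simp add: homog_def)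
  qed
  have "v \<in> ?A \<or> v \<in> ?B \<or> v \<in> ?C"
  proof -
    obtain x y z where xyz: "v = (x, y, z)" by (cases v)
    have iff: "v \<in> ?C \<longleftrightarrow> (?u v - k * z) * z > 0 \<or> z = 0"
      using unbounded_component_iff[of x y z] v by (simp add: xyz)
    from v[unfolded xyz] show ?thesis
    proof (cases rule: curve_lift_cases)
      case infinity
      then show ?thesis using iff by simp
    next
      case (affine u w)
      have u: "?u v = u * z"
        using affine by (simp add: xyz algebra_simps)
      have "(?u v - k * z) * z = (u - k) * z ^ 2"
        unfolding u by (simp add: algebra_simps power2_eq_square)
      then have "(?u v - k * z) * z \<noteq> 0"
        using affine by simp
      \<comment> \<open>At u = 0 the cofactor is k^2 z^2, so \<open>?A\<close> and \<open>?B\<close>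
        together cover the oval.\<close>
      moreover have "?q v \<noteq> 0" if "?u v = 0"
        using that affine(1) k_pos by (simp add: xyz)
      ultimately consider "(?u v - k * z) * z < 0" "?u v \<noteq> 0"
        | "(?u v - k * z) * z < 0" "?q v \<noteq> 0" | "(?u v - k * z) * z > 0"
        by (meson linorder_neqE_linordered_idom)
      then show ?thesis
      proof cases
        case 1
        then have "v \<in> ?A" by (simp add: xyz)
        then show ?thesis by blast
      next
        case 2
        then have "v \<in> ?B" by (simp add: xyz)
        then show ?thesis by blast
      next
        case 3
        then show ?thesis using iff by blast
      qed
    qed
  qed
  then show "\<exists>W. open W \<and> v \<in> W \<and>
      continuous_on (curve_lift \<inter> W) (\<lambda>v. half_negation e k (abs_rp2 v))"
    using A B C \<open>open ?A\<close> \<open>open ?B\<close> \<open>open ?C\<close> by blast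
qed

end

theorem theorem3p2:
  fixes a b :: real
  assumes "discriminant a b \<noteq> 0"
  shows "(\<exists>f. inverse_ambiguous (ec_group a b) f \<and> continuous_on (real_points a b) f)
    \<longleftrightarrow> discriminant a b > 0"
proof
  assume "\<exists>f. inverse_ambiguous (ec_group a b) f \<and> continuous_on (real_points a b) f"
  then show "discriminant a b > 0"
    using no_continuous_inverse_ambiguous assms by (metis linorder_neqE_linordered_idom)
next
  assume "discriminant a b > 0"
  then obtain e k where ek: "e ^ 3 + a * e + b = 0" "k > 0" "k ^ 2 = 3 * e ^ 2 + a" "3 * e + 2 * k < 0"
    by (rule positive_discriminant_root)
  have "inverse_ambiguous (ec_group a b) (half_negation e k)"
    using half_negation_in[OF ek] half_negation_twice[OF ek]
    by (auto simp: inverse_ambiguous_ec_group_iff)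
  then show "\<exists>f. inverse_ambiguous (ec_group a b) f \<and> continuous_on (real_points a b) f"
    using continuous_on_half_negation[OF ek] by blast
qed

end
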